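(* Let $\mathcal T=\{(s,t)\in\mathbb R^2: 0\le s\le t\}$. For $(s,t)\in\mathcal T$ let $E_i^{[s,t]}$, $i=0,\dots,5$, be the three-dimensional real evolution algebra with respect to the basis $e_1,e_2,e_3$ whose matrix of structural constants is the matrix $\mathcal M_i^{[s,t]}$ given in the context, and let $\mathcal Id(E)$ denote the set of idempotent elements of $E$, written in coordinates with respect to $e_1,e_2,e_3$. Then for every $(s,t)\in\mathcal T$ (and for every choice of the parameter functions and of the constant $a>0$ allowed in the context): (1) $\mathcal Id(E_0^{[s,t]})=\{(0,0,0)\}$. (2) $\mathcal Id(E_1^{[s,t]})=\{(0,0,0)\}$ if $h(t)=0$, and $\mathcal Id(E_1^{[s,t]})=\left\{(0,0,0),\left(\frac{h(s)}{h(t)},\frac{h(s)}{h(t)},\frac{h(s)}{h(t)}\right)\right\}$ if $h(t)\ne0$. (3) $\mathcal Id(E_2^{[s,t]})=\{(0,0,0)\}$ if $t\ge a$, and $\mathcal Id(E_2^{[s,t]})=\{(0,0,0),(1,1,1)\}$ if $s\le t<a$. (4) Put $F(s,t)=\frac{1}{\Phi(s)}\left(g_1(t)^2+\psi(s)g_2(t)^2+\varphi(s)g_3(t)^2\right)$. Then $\mathcal Id(E_3^{[s,t]})=\{(0,0,0)\}$ if $F(s,t)=0$, and $\mathcal Id(E_3^{[s,t]})=\left\{(0,0,0),\left(\frac{g_1(t)}{F(s,t)},\frac{g_2(t)}{F(s,t)},\frac{g_3(t)}{F(s,t)}\right)\right\}$ if $F(s,t)\neq0$. (5) $\mathcal Id(E_4^{[s,t]})=\{(0,0,0)\}$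 if $g(t)=0$, and $\mathcal Id(E_4^{[s,t]})=\left\{(0,0,0),\left(\frac{g(s)\varphi(t)}{g(t)^2},\frac{g(s)f(t)}{g(t)^2},\frac{g(s)}{g(t)}\right)\right\}$ if $g(t)\ne0$. (6) $\mathcal Id(E_5^{[s,t]})=\{(0,0,0),(\varphi(t),\psi(t),1)\}$ if $s\le t<a$, and $\mathcal Id(E_5^{[s,t]})=\{(0,0,0)\}$ if $t\ge a$.
   Context: A three-dimensional evolution algebra over $\mathbb R$ with basis $e_1,e_2,e_3$ and matrix of structural constants $\mathcal M=(a_{ij})_{i,j=1,2,3}$ is the algebra with multiplication $e_ie_i=\sum_{j=1}^3a_{ij}e_j$ and $e_ie_j=0$ for $i\neq j$, extended bilinearly. Thus for $x=\sum_i x_ie_i$ one has $x^2=\sum_j\left(\sum_i a_{ij}x_i^2\right)e_j$. An element $x$ is idempotent if $x^2=x$ (so $0$ counts as an idempotent). The matrices are as follows, for $0\le s\le t$. All parameter functions are arbitrary real-valued functions on $[0,\infty)$, subject only to the conditions stated, chosen independently for each family. $\mathcal M_0^{[s,t]}=0$ (the zero $3\times3$ matrix). $\mathcal M_1^{[s,t]}$: all three columns are equal to $\frac12\left(h(t)\left(\tfrac1{h(s)}+f(s)\right),\ h(t)\left(\tfrac1{h(s)}-g(s)\right),\ h(t)\left(g(s)-f(s)\right)\right)^T$, where $h,f,g$ are functions with $h(s)\neq0$ for all $s$. $\mathcal M_2^{[s,t]}$: for a fixed constant $a>0$, if $s\le t<a$ all three columns are equal to $\frac12\left(1+\psi(s),\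 1-\varphi(s),\ \varphi(s)-\psi(s)\right)^T$; if $t\ge a$ it is the zero matrix. Here $\varphi,\psi$ are functions. $\mathcal M_3^{[s,t]}=\frac1{\Phi(s)}\begin{pmatrix} g_1(t)&g_2(t)&g_3(t)\\ \psi(s)g_1(t)&\psi(s)g_2(t)&\psi(s)g_3(t)\\ \varphi(s)g_1(t)&\varphi(s)g_2(t)&\varphi(s)g_3(t)\end{pmatrix}$, where $g_1,g_2,g_3,\psi,\varphi$ are functions such that $\Phi(s)=g_1(s)+\psi(s)g_2(s)+\varphi(s)g_3(s)\neq0$ for all $s$. $\mathcal M_4^{[s,t]}=\begin{pmatrix}0&0&0\\0&0&0\\ \frac{\varphi(t)}{g(s)}&\frac{f(t)}{g(s)}&\frac{g(t)}{g(s)}\end{pmatrix}$, where $\varphi,f,g$ are functions with $g(s)\ne0$ for all $s$. $\mathcal M_5^{[s,t]}$: for a fixed constant $a>0$, if $s\le t<a$ it equals $\begin{pmatrix}0&0&0\\0&0&0\\ \varphi(t)&\psi(t)&1\end{pmatrix}$; if $t\ge a$ it is the zero matrix. Here $\varphi,\psi$ are functions. *)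

theory Defs
  imports "HOL-Analysis.Analysis"
begin

text \<open>
  The algebra with structural matrix \<open>M\<close> lives on \<open>real^3\<close>, and the basis vector \<open>e\<^sub>i\<close> is
  \<open>axis i 1\<close>.  The entry \<open>a\<^sub>i\<^sub>j\<close> is \<open>M $ i $ j\<close>, so the coordinates of \<open>e\<^sub>i e\<^sub>i\<close> form row \<open>i\<close>.
\<close>

definition basis_mult :: "real^3^3 \<Rightarrow> 3 \<Rightarrow> 3 \<Rightarrow> real^3" where
  "basis_mult M i j = (if i = j then (\<Sum>k\<in>UNIV. (M $ i $ k) *\<^sub>R axis k 1) else 0)"

definition evol_mult :: "real^3^3 \<Rightarrow> real^3 \<Rightarrow> real^3 \<Rightarrow> real^3" where
  "evol_mult M x y = (\<Sum>i\<in>UNIV. \<Sum>j\<in>UNIV. (x $ i * y $ j) *\<^sub>R basis_mult M i j)"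

lemma bilinear_evol_mult: "bilinear (evol_mult M)"
  unfolding bilinear_def evol_mult_def
  by (auto intro!: linearI simp: sum.distrib scaleR_sum_right algebra_simps)

lemma evol_mult_axis: "evol_mult M (axis i 1) (axis j 1) = basis_mult M i j"
proof -
  have "evol_mult M (axis i 1) (axis j 1)
      = (\<Sum>k\<in>UNIV. \<Sum>l\<in>UNIV. if l = j then (if k = i then basis_mult M k l else 0) else 0)"
    unfolding evol_mult_def axis_def by (intro sum.cong refl) auto
  then show ?thesis by simp
qed

definition idempotents :: "real^3^3 \<Rightarrow> (real^3) set" where
  "idempotents M = {x. evol_mult M x x = x}"

text \<open>
  Parameter functions on \<open>[0, \<infinity>)\<close> are represented by functions on \<open>real\<close>; only their values
  at nonnegative arguments matter below.
\<close>

definition M0 :: "real \<Rightarrow> real \<Rightarrow> real^3^3" where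
  "M0 s t = 0"

definition M1 :: "(real \<Rightarrow> real) \<Rightarrow> (real \<Rightarrow> real) \<Rightarrow> (real \<Rightarrow> real) \<Rightarrow> real \<Rightarrow> real \<Rightarrow> real^3^3" where
  "M1 h f g s t = (\<chi> i j. (1/2) *
     (vector [h t * (1 / h s + f s), h t * (1 / h s - g s), h t * (g s - f s)] :: real^3) $ i)"

definition M2 :: "real \<Rightarrow> (real \<Rightarrow> real) \<Rightarrow> (real \<Rightarrow> real) \<Rightarrow> real \<Rightarrow> real \<Rightarrow> real^3^3" where
  "M2 a \<phi> \<psi> s t =
     (if t < a
      then (\<chi> i j. (1/2) * (vector [1 + \<psi> s, 1 - \<phi> s, \<phi> s - \<psi> s] :: real^3) $ i)
      else 0)"

definition Phi :: "(real \<Rightarrow> real) \<Rightarrow> (real \<Rightarrow> real) \<Rightarrow> (real \<Rightarrow> real) \<Rightarrow>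
    (real \<Rightarrow> real) \<Rightarrow> (real \<Rightarrow> real) \<Rightarrow> real \<Rightarrow> real" where
  "Phi g1 g2 g3 \<psi> \<phi> s = g1 s + \<psi> s * g2 s + \<phi> s * g3 s"

definition M3 :: "(real \<Rightarrow> real) \<Rightarrow> (real \<Rightarrow> real) \<Rightarrow> (real \<Rightarrow> real) \<Rightarrow>
    (real \<Rightarrow> real) \<Rightarrow> (real \<Rightarrow> real) \<Rightarrow> real \<Rightarrow> real \<Rightarrow> real^3^3" where
  "M3 g1 g2 g3 \<psi> \<phi> s t = (1 / Phi g1 g2 g3 \<psi> \<phi> s) *\<^sub>R vector
     [vector [g1 t, g2 t, g3 t],
      vector [\<psi> s * g1 t, \<psi> s * g2 t, \<psi> s * g3 t],
      vector [\<phi> s * g1 t, \<phi> s * g2 t, \<phi> s * g3 t]]"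

definition F :: "(real \<Rightarrow> real) \<Rightarrow> (real \<Rightarrow> real) \<Rightarrow> (real \<Rightarrow> real) \<Rightarrow>
    (real \<Rightarrow> real) \<Rightarrow> (real \<Rightarrow> real) \<Rightarrow> real \<Rightarrow> real \<Rightarrow> real" where
  "F g1 g2 g3 \<psi> \<phi> s t =
     1 / Phi g1 g2 g3 \<psi> \<phi> s * ((g1 t)\<^sup>2 + \<psi> s * (g2 t)\<^sup>2 + \<phi> s * (g3 t)\<^sup>2)"

definition M4 :: "(real \<Rightarrow> real) \<Rightarrow> (real \<Rightarrow> real) \<Rightarrow> (real \<Rightarrow> real) \<Rightarrow> real \<Rightarrow> real \<Rightarrow> real^3^3" where
  "M4 \<phi> f g s t = vector
     [vector [0, 0, 0],
      vector [0, 0, 0],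
      vector [\<phi> t / g s, f t / g s, g t / g s]]"

definition M5 :: "real \<Rightarrow> (real \<Rightarrow> real) \<Rightarrow> (real \<Rightarrow> real) \<Rightarrow> real \<Rightarrow> real \<Rightarrow> real^3^3" where
  "M5 a \<phi> \<psi> s t =
     (if t < a
      then vector
        [vector [0, 0, 0],
         vector [0, 0, 0],
         vector [\<phi> t, \<psi> t, 1]]
      else 0)"

end

(* Every structural matrix here has rank at most one, M = u v^T, so that
   x^2 = (sum_i u_i x_i^2) v.  A nonzero idempotent is therefore a multiple c v, and
   c v = (c v)^2 = c^2 D v with D = sum_i u_i v_i^2 forces c = 1 / D. *)

theory Submission
  imports Defs
begin

text \<open>Mixed products of basis vectors vanish, so the double sum collapses to its
  diagonal.\<close>

lemma evol_mult_nth: "evol_mult M x y $ j = (\<Sum>i\<in>UNIV. x $ i * y $ i * M $ i $ j)"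
proof -
  have "evol_mult M x y $ j =
      (\<Sum>i\<in>UNIV. \<Sum>k\<in>UNIV. if i = k then x $ i * y $ k * M $ i $ j else 0)"
    unfolding evol_mult_def basis_mult_def sum_component vector_scaleR_component
    by (intro sum.cong refl) (simp add: axis_def if_distrib cong: if_cong)
  then show ?thesis by simp
qed

text \<open>All six families are instances of this. \<open>D\<close> is a separate variable so that
  each family can supply its own closed form and leave the agreement with the sum as a side
  goal.\<close>

lemma idempotents_rank_one:
  fixes u v :: "real^3" and M :: "real^3^3"
  assumes M: "\<And>i j. M $ i $ j = u $ i * v $ j"
    and D: "D = (\<Sum>i\<in>UNIV. u $ i * (v $ i)\<^sup>2)"
  shows "idempotents M = (if D = 0 then {0} else {0, (1 / D) *\<^sub>R v})"
proof -
  have sq: "evol_mult M x x = (\<Sum>i\<in>UNIV. u $ i * (x $ i)\<^sup>2) *\<^sub>R v" for x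
    unfolding vec_eq_iff vector_scaleR_component sum_distrib_right real_scaleR_def
    by (simp add: evol_mult_nth M power2_eq_square mult_ac)
  have sq_scale: "evol_mult M (c *\<^sub>R v) (c *\<^sub>R v) = (c * (c * D)) *\<^sub>R v" for c
    by (simp add: sq D sum_distrib_left power2_eq_square mult_ac)
  have "x = 0 \<or> (D \<noteq> 0 \<and> x = (1 / D) *\<^sub>R v)" if "evol_mult M x x = x" for x
  proof -
    obtain c where x: "x = c *\<^sub>R v"
      \<comment> \<open>The witness \<open>c\<close> is the scalar in \<open>sq\<close>, that is,
        the sum of \<open>u $ i * (x $ i)\<^sup>2\<close>.\<close>
      by (rule that, rule trans[OF sym[OF \<open>evol_mult M x x = x\<close>] sq])
    have "(c * (c * D)) *\<^sub>R v = c *\<^sub>R v"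
      using \<open>evol_mult M x x = x\<close> unfolding x sq_scale .
    \<comment> \<open>Either \<open>v\<close> vanishes or the scalars agree, c^2 D = c. The
      alternatives \<open>v = 0\<close> and \<open>c = 0\<close> both give
      \<open>x = 0\<close>.\<close>
    then have "v = 0 \<or> c = 0 \<or> c * D = 1" by auto
    then consider "x = 0" | "c * D = 1" using x by auto
    then show ?thesis
    proof cases
      case 2
      then have "D \<noteq> 0" and "c = 1 / D" by (auto simp: eq_divide_eq)
      then show ?thesis using x by blast
    qed blast
  qed
  moreover have "evol_mult M 0 0 = 0" by (simp add: sq)
  moreover have "evol_mult M ((1 / D) *\<^sub>R v) ((1 / D) *\<^sub>R v) = (1 / D) *\<^sub>R v" if "D \<noteq> 0"
    unfolding sq_scale using that by simp
  ultimately show ?thesis unfolding idempotents_def by auto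
qed

lemma vector3_zero: "vector [0, 0, 0] = (0 :: real^3)"
  by (simp add: vec_eq_iff forall_3)

lemma scaleR_vector3: "c *\<^sub>R vector [x, y, z] = (vector [c * x, c * y, c * z] :: real^3)"
  by (simp add: vec_eq_iff forall_3)

lemma vector3_ones_nth: "vector [1, 1, 1] $ j = (1 :: real)" for j :: 3
  using exhaust_3[of j] by auto

lemma idempotents_zero: "idempotents 0 = {0}"
  using idempotents_rank_one[of 0 0 0 0] by simp

text \<open>Equal columns mean that v = (1, 1, 1) and u is the common column, so D is the sum of its
  entries. There f(s) and g(s) cancel, which leaves D = h(t)/h(s); as h(s) is nonzero, D vanishes
  exactly when h(t) does.\<close>

lemma idempotents_M1:
  assumes "h s \<noteq> 0"
  shows "idempotents (M1 h f g s t) =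
    (if h t = 0 then {0} else {0, vector [h s / h t, h s / h t, h s / h t]})"
proof -
  let ?u = "(1/2) *\<^sub>R vector [h t * (1 / h s + f s), h t * (1 / h s - g s), h t * (g s - f s)] :: real^3"
  have "idempotents (M1 h f g s t) =
    (if h t / h s = 0 then {0} else {0, (1 / (h t / h s)) *\<^sub>R vector [1, 1, 1]})"
    by (rule idempotents_rank_one[where u = ?u])
      (simp_all add: M1_def vector3_ones_nth sum_3 flip: add_divide_distrib, simp add: algebra_simps)
  then show ?thesis using assms by (simp add: scaleR_vector3)
qed

text \<open>For t < a the columns are again equal, and the entries of one column sum to D = 1
  because \<phi>(s) and \<psi>(s) cancel.\<close>

lemma idempotents_M2:
  "idempotents (M2 a \<phi> \<psi> s t) = (if t < a then {0, vector [1, 1, 1]} else {0})"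
proof (cases "t < a")
  case True
  let ?u = "(1/2) *\<^sub>R vector [1 + \<psi> s, 1 - \<phi> s, \<phi> s - \<psi> s] :: real^3"
  have "idempotents (M2 a \<phi> \<psi> s t) =
    (if (1::real) = 0 then {0} else {0, (1 / 1) *\<^sub>R vector [1, 1, 1]})"
    by (rule idempotents_rank_one[where u = ?u])
      (use True in \<open>simp_all add: M2_def vector3_ones_nth sum_3 flip: add_divide_distrib\<close>)
  then show ?thesis using True by simp
qed (simp add: M2_def idempotents_zero)

text \<open>Row i is a multiple of v = (g1(t), g2(t), g3(t)), with factors u = (1, \<psi>(s),
  \<phi>(s))/\<Phi>(s). With this splitting the scalar D of the rank-one lemma is precisely
  \<open>F\<close>.\<close>

lemma idempotents_M3:
  fixes g1 g2 g3 \<psi> \<phi> :: "real \<Rightarrow> real"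
  defines "D \<equiv> F g1 g2 g3 \<psi> \<phi>"
  shows "idempotents (M3 g1 g2 g3 \<psi> \<phi> s t) =
    (if D s t = 0 then {0} else {0, vector [g1 t / D s t, g2 t / D s t, g3 t / D s t]})"
proof -
  let ?u = "(1 / Phi g1 g2 g3 \<psi> \<phi> s) *\<^sub>R vector [1, \<psi> s, \<phi> s] :: real^3"
  have "M3 g1 g2 g3 \<psi> \<phi> s t $ i $ j = ?u $ i * vector [g1 t, g2 t, g3 t] $ j" for i j
    using exhaust_3[of i] exhaust_3[of j] by (auto simp: M3_def)
  moreover have "D s t = (\<Sum>i\<in>UNIV. ?u $ i * (vector [g1 t, g2 t, g3 t] $ i)\<^sup>2)"
    by (simp add: D_def F_def sum_3 add_divide_distrib)
  ultimately have "idempotents (M3 g1 g2 g3 \<psi> \<phi> s t) =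
    (if D s t = 0 then {0} else {0, (1 / D s t) *\<^sub>R vector [g1 t, g2 t, g3 t]})"
    by (rule idempotents_rank_one)
  then show ?thesis by (simp add: scaleR_vector3)
qed

text \<open>Only the third row is nonzero, so only the third coordinate of v enters D. Placing
  1/g(s) in u gives v_3 = g(t) and D = g(t)^2/g(s); in the third coordinate of v/D one factor g(t)
  cancels.\<close>

lemma idempotents_M4:
  assumes "g s \<noteq> 0"
  shows "idempotents (M4 \<phi> f g s t) = (if g t = 0 then {0}
    else {0, vector [g s * \<phi> t / (g t)\<^sup>2, g s * f t / (g t)\<^sup>2, g s / g t]})"
proof -
  let ?u = "vector [0, 0, 1 / g s] :: real^3"
  let ?v = "vector [\<phi> t, f t, g t] :: real^3"
  have "M4 \<phi> f g s t $ i $ j = ?u $ i * ?v $ j" for i j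
    using exhaust_3[of i] exhaust_3[of j] by (auto simp: M4_def)
  then have "idempotents (M4 \<phi> f g s t) =
    (if (g t)\<^sup>2 / g s = 0 then {0} else {0, (1 / ((g t)\<^sup>2 / g s)) *\<^sub>R ?v})"
    by (rule idempotents_rank_one) (simp add: sum_3)
  then show ?thesis using assms by (simp add: scaleR_vector3 power2_eq_square)
qed

text \<open>For t < a the third row itself serves as v, and its last entry 1 gives D = 1, so v is
  the nonzero idempotent.\<close>

lemma idempotents_M5:
  "idempotents (M5 a \<phi> \<psi> s t) = (if t < a then {0, vector [\<phi> t, \<psi> t, 1]} else {0})"
proof (cases "t < a")
  case True
  let ?u = "vector [0, 0, 1] :: real^3"
  let ?v = "vector [\<phi> t, \<psi> t, 1] :: real^3"
  have "M5 a \<phi> \<psi> s t $ i $ j = ?u $ i * ?v $ j" for i j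
    using exhaust_3[of i] exhaust_3[of j] True by (auto simp: M5_def)
  then have "idempotents (M5 a \<phi> \<psi> s t) =
    (if (1::real) = 0 then {0} else {0, (1 / 1) *\<^sub>R ?v})"
    by (rule idempotents_rank_one) (simp add: sum_3)
  then show ?thesis using True by simp
qed (simp add: M5_def idempotents_zero)

theorem theorem4:
  fixes s t :: real
  assumes "0 \<le> s" and "s \<le> t"
  shows
    "idempotents (M0 s t) = {vector [0, 0, 0]}
   \<and> (\<forall>h f g :: real \<Rightarrow> real. (\<forall>u\<ge>0. h u \<noteq> 0) \<longrightarrow>
        (h t = 0 \<longrightarrow> idempotents (M1 h f g s t) = {vector [0, 0, 0]})
      \<and> (h t \<noteq> 0 \<longrightarrow> idempotents (M1 h f g s t)
            = {vector [0, 0, 0], vector [h s / h t, h s / h t, h s / h t]}))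
   \<and> (\<forall>(a :: real) (\<phi> :: real \<Rightarrow> real) (\<psi> :: real \<Rightarrow> real). a > 0 \<longrightarrow>
        (t \<ge> a \<longrightarrow> idempotents (M2 a \<phi> \<psi> s t) = {vector [0, 0, 0]})
      \<and> (s \<le> t \<and> t < a \<longrightarrow> idempotents (M2 a \<phi> \<psi> s t)
            = {vector [0, 0, 0], vector [1, 1, 1]}))
   \<and> (\<forall>g1 g2 g3 \<psi> \<phi> :: real \<Rightarrow> real. (\<forall>u\<ge>0. Phi g1 g2 g3 \<psi> \<phi> u \<noteq> 0) \<longrightarrow>
        (F g1 g2 g3 \<psi> \<phi> s t = 0 \<longrightarrow>
           idempotents (M3 g1 g2 g3 \<psi> \<phi> s t) = {vector [0, 0, 0]})
      \<and> (F g1 g2 g3 \<psi> \<phi> s t \<noteq> 0 \<longrightarrow>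
           idempotents (M3 g1 g2 g3 \<psi> \<phi> s t)
            = {vector [0, 0, 0],
               vector [g1 t / F g1 g2 g3 \<psi> \<phi> s t,
                       g2 t / F g1 g2 g3 \<psi> \<phi> s t,
                       g3 t / F g1 g2 g3 \<psi> \<phi> s t]}))
   \<and> (\<forall>\<phi> f g :: real \<Rightarrow> real. (\<forall>u\<ge>0. g u \<noteq> 0) \<longrightarrow>
        (g t = 0 \<longrightarrow> idempotents (M4 \<phi> f g s t) = {vector [0, 0, 0]})
      \<and> (g t \<noteq> 0 \<longrightarrow> idempotents (M4 \<phi> f g s t)
            = {vector [0, 0, 0],
               vector [g s * \<phi> t / (g t)\<^sup>2, g s * f t / (g t)\<^sup>2, g s / g t]}))
   \<and> (\<forall>(a :: real) (\<phi> :: real \<Rightarrow> real) (\<psi> :: real \<Rightarrow> real). a > 0 \<longrightarrow>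
        (s \<le> t \<and> t < a \<longrightarrow> idempotents (M5 a \<phi> \<psi> s t)
            = {vector [0, 0, 0], vector [\<phi> t, \<psi> t, 1]})
      \<and> (t \<ge> a \<longrightarrow> idempotents (M5 a \<phi> \<psi> s t) = {vector [0, 0, 0]}))"
  \<comment> \<open>The bound \<open>0 \<le> s\<close> makes the nonvanishing hypotheses available
    at \<open>s\<close>, as \<open>idempotents_M1\<close> and \<open>idempotents_M4\<close> require;
    \<open>vector3_zero\<close> turns the coordinate triple into the \<open>0\<close> of the
    lemmas.\<close>
  using assms
  by (simp add: vector3_zero M0_def idempotents_zero idempotents_M1 idempotents_M2
      idempotents_M3 idempotents_M4 idempotents_M5)

end
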